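(* Fix $t\in\mathbb{R}$ and suppose that the amplitude- and frequency-modulated signal $f$ is such that $s\mapsto|W_f(t,s)|$ has a unique maximizer on $(0,\infty)$, denoted $s_f(t)=\arg\max_{s>0}|W_f(t,s)|$. Let $s>0$ with $s\ne s_f(t)$, let $\delta\in[0,1)$, assume $\mathbb{E}[|W_\Phi(t,s)|^2]>0$ and $\mathbb{E}[|W_\Phi(t,s_f(t))|^2]>0$, and set, for $s'\in\{s,s_f(t)\}$, $q(t,s')=|W_f(t,s')|^2/\mathbb{E}[|W_\Phi(t,s')|^2]$. Then $$\mathbb{P}\left(|W_Y(t,s_f(t))|<(1-\delta)|W_Y(t,s)|\right)\le e^{-\frac{\varepsilon^2}{16}q(t,s_f(t))}+e^{-\frac{\varepsilon}{2}q(t,s_f(t))}+e^{-\frac{\varepsilon^2}{16}q(t,s)}+e^{-\frac{\varepsilon}{2}q(t,s)},$$ where $$\varepsilon=\frac{|W_f(t,s_f(t))|-(1-\delta)|W_f(t,s)|}{|W_f(t,s_f(t))|+(1-\delta)|W_f(t,s)|}.$$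
   Context: The function $\psi:\mathbb{R}\to\mathbb{C}$ belongs to $L^1(\mathbb{R})\cap L^2(\mathbb{R})$, with Fourier transform $\widehat\psi(\omega)=\int_{\mathbb{R}}e^{-it\omega}\psi(t)\,dt$. It is an analytic mother wavelet: $\widehat\psi(\omega)=0$ for $\omega\le0$; moreover $|\widehat\psi|$ is unimodal with a unique maximum point in $(0,\infty)$. The function $f:\mathbb{R}\to\mathbb{R}$ is bounded and deterministic; "amplitude- and frequency-modulated" carries no formal requirement beyond this. The noise $\Phi=\{\Phi(t)\}_{t\in\mathbb{R}}$ is a real-valued stationary Gaussian process with constant mean and covariance function $C_\Phi(t_1-t_2)=\mathrm{Cov}(\Phi(t_1),\Phi(t_2))$, which has the spectral representation $C_\Phi(t)=\int_{\mathbb{R}}e^{i\lambda t}F(d\lambda)$ with $F$ a nonnegative measure, $F(\mathbb{R})=C_\Phi(0)$. The observed signal is $Y=f+\Phi$. For $g\in\{f,\Phi,Y\}$, the analytic wavelet transform is $W_g(t,s)=\int_{\mathbb{R}}g(\tau)\frac{1}{\sqrt s}\overline{\psi\left(\frac{\tau-t}{s}\right)}d\tau$, $t\in\mathbb{R}$, $s>0$. *)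

theory Defs
  imports "HOL-Probability.Probability"
begin

definition fourier :: "(real \<Rightarrow> complex) \<Rightarrow> real \<Rightarrow> complex" where
  "fourier \<psi> w = (LINT t|lebesgue. exp (- (\<i> * of_real (t * w))) * \<psi> t)"

definition unimodal_on :: "real set \<Rightarrow> (real \<Rightarrow> real) \<Rightarrow> bool" where
  "unimodal_on S g \<longleftrightarrow>
     (\<exists>p\<in>S. mono_on (S \<inter> {..p}) g \<and> antimono_on (S \<inter> {p..}) g \<and> (\<forall>x\<in>S. x \<noteq> p \<longrightarrow> g x < g p))"

definition analytic_mother_wavelet :: "(real \<Rightarrow> complex) \<Rightarrow> bool" where
  "analytic_mother_wavelet \<psi> \<longleftrightarrow>
     integrable lebesgue \<psi> \<and>
     integrable lebesgue (\<lambda>x. (cmod (\<psi> x))\<^sup>2) \<and>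
     (\<forall>w\<le>0. fourier \<psi> w = 0) \<and>
     unimodal_on {0<..} (\<lambda>w. cmod (fourier \<psi> w))"

definition awt :: "(real \<Rightarrow> complex) \<Rightarrow> (real \<Rightarrow> real) \<Rightarrow> real \<Rightarrow> real \<Rightarrow> complex" where
  "awt \<psi> g t s =
     (LINT \<tau>|lebesgue. of_real (g \<tau>) * of_real (1 / sqrt s) * cnj (\<psi> ((\<tau> - t) / s)))"

text \<open>Degenerate (constant) Gaussian variables are admitted, as is needed for linear combinations
  of the values of a Gaussian process.\<close>

definition gaussian_rv :: "'a measure \<Rightarrow> ('a \<Rightarrow> real) \<Rightarrow> bool" where
  "gaussian_rv M X \<longleftrightarrow>
     X \<in> borel_measurable M \<and>
     (\<exists>m \<sigma>. \<sigma> \<ge> 0 \<and>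
        distr M borel X = (if \<sigma> = 0 then return borel m else density lborel (normal_density m \<sigma>)))"

definition gaussian_process :: "'a measure \<Rightarrow> (real \<Rightarrow> 'a \<Rightarrow> real) \<Rightarrow> bool" where
  "gaussian_process M \<Phi> \<longleftrightarrow>
     (\<forall>I a. finite I \<longrightarrow> gaussian_rv M (\<lambda>\<omega>. \<Sum>t\<in>I. a t * \<Phi> t \<omega>))"

definition covariance :: "'a measure \<Rightarrow> ('a \<Rightarrow> real) \<Rightarrow> ('a \<Rightarrow> real) \<Rightarrow> real" where
  "covariance M X Y =
     (LINT \<omega>|M. (X \<omega> - (LINT \<eta>|M. X \<eta>)) * (Y \<omega> - (LINT \<eta>|M. Y \<eta>)))"

text \<open>For a Gaussian process, constant mean together with a covariance depending only on the time
  lag is equivalent to shift invariance of all finite-dimensional distributions.\<close>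

definition stationary_with_covariance ::
    "'a measure \<Rightarrow> (real \<Rightarrow> 'a \<Rightarrow> real) \<Rightarrow> (real \<Rightarrow> real) \<Rightarrow> bool" where
  "stationary_with_covariance M \<Phi> C \<longleftrightarrow>
     (\<exists>m. \<forall>t. (LINT \<omega>|M. \<Phi> t \<omega>) = m) \<and>
     (\<forall>t1 t2. covariance M (\<Phi> t1) (\<Phi> t2) = C (t1 - t2))"

definition spectral_representation :: "(real \<Rightarrow> real) \<Rightarrow> real measure \<Rightarrow> bool" where
  "spectral_representation C F \<longleftrightarrow>
     sets F = sets borel \<and>
     emeasure F UNIV = ennreal (C 0) \<and>
     (\<forall>t. complex_of_real (C t) = (LINT x|F. exp (\<i> * of_real (x * t))))"

text \<open>Joint measurability in time and outcome, which the pathwise integral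
  \<^term>\<open>awt \<psi> (\<lambda>\<tau>. \<Phi> \<tau> \<omega>) t s\<close> needs in order to be a random variable.\<close>

definition measurable_process :: "'a measure \<Rightarrow> (real \<Rightarrow> 'a \<Rightarrow> real) \<Rightarrow> bool" where
  "measurable_process M \<Phi> \<longleftrightarrow>
     (\<lambda>(\<tau>, \<omega>). \<Phi> \<tau> \<omega>) \<in> borel_measurable (lebesgue \<Otimes>\<^sub>M M)"

end

theory Submission
  imports Defs
begin

text \<open>
  The argument has a deterministic half and a probabilistic half. Put
  \<open>A = \<bar>W\<^sub>f(t, s\<^sub>f)\<bar>\<close> and \<open>B = (1 - \<delta>) \<bar>W\<^sub>f(t, s)\<bar>\<close>, so that \<open>B < A\<close>. The number \<open>\<epsilon>\<close> is chosen
  such that \<open>(1 - \<epsilon>) A = (1 + \<epsilon>) B\<close>: a perturbation of relative size at most \<open>\<epsilon>\<close> of either transform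
  cannot reverse their order. As \<open>W\<^sub>Y = W\<^sub>f + W\<^sub>\<Phi>\<close> almost surely, the event in question forces
  \<open>\<bar>W\<^sub>\<Phi>(t, s')\<bar> > \<epsilon> \<bar>W\<^sub>f(t, s')\<bar>\<close> for \<open>s' = s\<^sub>f\<close> or \<open>s' = s\<close> (\<open>ridge_misplaced_imp_noise_large\<close>).

  The noise transform \<open>W = W\<^sub>\<Phi>(t, s')\<close> is a circularly symmetric complex Gaussian variable, because
  the wavelet is analytic: \<open>E W\<^sup>2\<close> is the spectral integral of the Fourier transform of the kernel at
  \<open>x\<close> times that at \<open>-x\<close>, and one of these factors always vanishes. Hence \<open>\<bar>W\<bar>\<^sup>2\<close> is exponentially
  distributed, \<open>P(\<bar>W\<bar> > r) = exp (- r\<^sup>2 / E \<bar>W\<bar>\<^sup>2)\<close>. With \<open>r = \<epsilon> \<bar>W\<^sub>f(t, s')\<bar>\<close> each of the two events has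
  probability at most \<open>exp (- \<epsilon>\<^sup>2 q(t, s'))\<close>, and this is at most \<open>exp (- \<epsilon>\<^sup>2 q(t, s') / 16)\<close>.

  Two points carry the work. First, \<open>W\<close> is a pathwise integral, and only finite linear combinations
  of the values of \<open>\<Phi>\<close> are Gaussian by definition. The lemma \<open>char_path_integral\<close> replaces the integration variable
  by simple functions that converge to it; mean-square continuity of \<open>\<Phi>\<close>, which comes from the
  spectral representation, makes the approximations converge in \<open>L\<^sup>1\<close>, and characteristic functions
  pass to the limit. With \<open>circular_of_analytic_kernel\<close> this gives the joint characteristic function of
  the real and imaginary parts of \<open>W\<close>. Second, the tail of \<open>\<bar>W\<bar>\<close> is read off that function without any
  inversion theorem in the plane: averaging it over a Gaussian frequency yields the Laplace transform of
  \<open>\<bar>W\<bar>\<^sup>2\<close> (\<open>circular_gaussian_laplace\<close>), whose values at integer multiples of \<open>1 / E \<bar>W\<bar>\<^sup>2\<close> say that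
  \<open>V = exp (- \<bar>W\<bar>\<^sup>2 / E \<bar>W\<bar>\<^sup>2)\<close> has the moments of the uniform distribution on \<open>[0, 1]\<close>. Weierstrass
  approximation then bounds \<open>P(V < c)\<close> by \<open>c\<close> (\<open>prob_less_le_if_uniform_moments\<close>), which is the tail
  bound (\<open>circular_gaussian_tail\<close>).
\<close>

section \<open>The modulus of a circularly symmetric complex Gaussian variable\<close>

lemma integral_pair_mult:
  fixes f :: "'a \<Rightarrow> 'c::{real_normed_field,banach,second_countable_topology}"
  assumes "prob_space A" "prob_space B"
    and [measurable]: "f \<in> borel_measurable A" "g \<in> borel_measurable B"
    and f: "\<And>x. norm (f x) \<le> 1" and g: "\<And>y. norm (g y) \<le> 1"
  shows "(\<integral>p. f (fst p) * g (snd p) \<partial>(A \<Otimes>\<^sub>M B)) = (\<integral>x. f x \<partial>A) * (\<integral>y. g y \<partial>B)"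
proof -
  interpret A: prob_space A by fact
  interpret B: prob_space B by fact
  interpret P: pair_prob_space A B ..
  have "norm (f x * g y) \<le> 1" for x y
    using mult_mono[OF f[of x] g[of y]] by (simp add: norm_mult)
  then have "integrable (A \<Otimes>\<^sub>M B) (\<lambda>p. f (fst p) * g (snd p))"
    by (intro P.P.integrable_const_bound[of _ 1]) auto
  from P.integral_fst'[OF this] show ?thesis by simp
qed

lemma std_normal_integral_exp_square:
  assumes "0 \<le> a"
  shows "(\<integral>x. exp (- (a * x\<^sup>2 / 2)) \<partial>std_normal_distribution) = 1 / sqrt (1 + a)"
proof -
  let ?\<sigma> = "1 / sqrt (1 + a)"
  have \<sigma>: "0 < ?\<sigma>" using assms by simp
  have "std_normal_density x * exp (- (a * x\<^sup>2 / 2)) = ?\<sigma> * normal_density 0 ?\<sigma> x" for x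
    using assms
    by (simp add: normal_density_def real_sqrt_divide real_sqrt_mult power_divide field_simps flip: exp_add)
  then have "(\<integral>x. exp (- (a * x\<^sup>2 / 2)) \<partial>std_normal_distribution) =
      (\<integral>x. ?\<sigma> * normal_density 0 ?\<sigma> x \<partial>lborel)"
    by (subst integral_density) (auto simp del: integral_mult_right_zero)
  then show ?thesis using integral_normal_density[OF \<sigma>] by simp
qed

text \<open>
  The factor \<open>exp (- l \<bar>w\<bar>\<^sup>2)\<close> is the characteristic function, at \<open>sqrt (2 l) w\<close>, of a standard Gaussian
  vector \<open>(N\<^sub>1, N\<^sub>2)\<close> in the plane. Taking this vector independent of \<open>W\<close> and exchanging the two
  expectations turns the Laplace transform of \<open>\<bar>W\<bar>\<^sup>2\<close> into a Gaussian average of the given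
  characteristic function of \<open>W\<close>, which is again an explicit Gaussian integral.
\<close>
lemma circular_gaussian_laplace:
  fixes W :: "'a \<Rightarrow> complex"
  assumes "prob_space M" and W[measurable]: "W \<in> borel_measurable M"
    and char: "\<And>z. (\<integral>\<omega>. iexp (Re (z * W \<omega>)) \<partial>M) = of_real (exp (- ((cmod z)\<^sup>2 * S / 4)))"
    and S: "0 \<le> S" and l: "0 \<le> l"
  shows "(\<integral>\<omega>. exp (- l * (cmod (W \<omega>))\<^sup>2) \<partial>M) = 1 / (1 + l * S)"
proof -
  interpret prob_space M by fact
  let ?N = std_normal_distribution
  let ?G = "?N \<Otimes>\<^sub>M ?N"
  interpret N: prob_space ?N by (rule prob_space_normal_density) simp
  interpret G: pair_prob_space ?N ?N ..
  interpret MG: pair_prob_space M ?G ..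
  define c where "c = sqrt (2 * l)"
  have c: "c\<^sup>2 = 2 * l" using l by (simp add: c_def)
  define z where "z p = of_real c * (of_real (fst p) - \<i> * of_real (snd p))" for p :: "real \<times> real"
  have [measurable]: "z \<in> borel_measurable ?G"
    unfolding z_def by measurable
  have N: "(\<integral>x. iexp (u * x) \<partial>?N) = of_real (exp (- (u\<^sup>2 / 2)))" for u
    using fun_cong[OF char_std_normal_distribution, of u] by (simp add: char_def)
  have randomise: "(\<integral>p. iexp (Re (z p * w)) \<partial>?G) = of_real (exp (- l * (cmod w)\<^sup>2))" for w
  proof -
    have "iexp (Re (z p * w)) = iexp ((c * Re w) * fst p) * iexp ((c * Im w) * snd p)" for p
      by (simp add: z_def algebra_simps flip: exp_add)
    then have "(\<integral>p. iexp (Re (z p * w)) \<partial>?G) =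
        (\<integral>x. iexp ((c * Re w) * x) \<partial>?N) * (\<integral>y. iexp ((c * Im w) * y) \<partial>?N)"
      using integral_pair_mult[OF N.prob_space_axioms N.prob_space_axioms,
          of "\<lambda>x. iexp ((c * Re w) * x)" "\<lambda>y. iexp ((c * Im w) * y)"]
      by (simp del: of_real_mult)
    also have "\<dots> = of_real (exp (- ((c * Re w)\<^sup>2 / 2)) * exp (- ((c * Im w)\<^sup>2 / 2)))"
      unfolding N by simp
    also have "exp (- ((c * Re w)\<^sup>2 / 2)) * exp (- ((c * Im w)\<^sup>2 / 2)) = exp (- l * (cmod w)\<^sup>2)"
      by (simp add: power_mult_distrib c cmod_power2 algebra_simps flip: exp_add)
    finally show ?thesis .
  qed
  have cz: "(cmod (z p))\<^sup>2 = 2 * l * ((fst p)\<^sup>2 + (snd p)\<^sup>2)" for p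
    unfolding z_def by (simp add: norm_mult power_mult_distrib c cmod_power2)
  have "integrable (M \<Otimes>\<^sub>M ?G) (\<lambda>(\<omega>, p). iexp (Re (z p * W \<omega>)))"
    by (intro MG.P.integrable_const_bound[of _ 1]) (auto simp: case_prod_beta)
  then have "(\<integral>\<omega>. (\<integral>p. iexp (Re (z p * W \<omega>)) \<partial>?G) \<partial>M) =
      (\<integral>p. (\<integral>\<omega>. iexp (Re (z p * W \<omega>)) \<partial>M) \<partial>?G)"
    by (rule MG.Fubini_integral[symmetric])
  then have "complex_of_real (\<integral>\<omega>. exp (- l * (cmod (W \<omega>))\<^sup>2) \<partial>M) =
      of_real (\<integral>p. exp (- ((cmod (z p))\<^sup>2 * S / 4)) \<partial>?G)"
    by (simp only: randomise char integral_complex_of_real)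
  then have "(\<integral>\<omega>. exp (- l * (cmod (W \<omega>))\<^sup>2) \<partial>M) = (\<integral>p. exp (- ((cmod (z p))\<^sup>2 * S / 4)) \<partial>?G)"
    by (simp only: of_real_eq_iff)
  also have "\<dots> = (\<integral>p. exp (- ((l * S) * (fst p)\<^sup>2 / 2)) * exp (- ((l * S) * (snd p)\<^sup>2 / 2)) \<partial>?G)"
    by (simp add: cz algebra_simps add_divide_distrib flip: exp_add)
  also have "\<dots> = (1 / sqrt (1 + l * S)) * (1 / sqrt (1 + l * S))"
    using S l std_normal_integral_exp_square[of "l * S"]
      integral_pair_mult[OF N.prob_space_axioms N.prob_space_axioms,
        of "\<lambda>x. exp (- ((l * S) * x\<^sup>2 / 2))" "\<lambda>x. exp (- ((l * S) * x\<^sup>2 / 2))"]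
    by simp
  also have "\<dots> = 1 / (1 + l * S)" using S l by simp
  finally show ?thesis .
qed

text \<open>
  A variable in \<open>[0, 1]\<close> with the moments of the uniform distribution has its expectation of
  every polynomial, hence by Weierstrass, up to a uniform error \<open>e\<close>, of the continuous ramp \<open>g\<close> that equals
  \<open>1\<close> up to \<open>c\<close> and \<open>0\<close> beyond \<open>c + e\<close>. The ramp dominates the indicator of \<open>{..<c}\<close> and is
  dominated by that of \<open>{..c + e}\<close>.
\<close>
lemma prob_less_le_if_uniform_moments:
  fixes V :: "'a \<Rightarrow> real"
  assumes "prob_space M" and [measurable]: "V \<in> borel_measurable M"
    and V01: "\<And>\<omega>. 0 \<le> V \<omega>" "\<And>\<omega>. V \<omega> \<le> 1"
    and mom: "\<And>n. (\<integral>\<omega>. V \<omega> ^ n \<partial>M) = 1 / (real n + 1)"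
    and c: "0 \<le> c"
  shows "measure M {\<omega> \<in> space M. V \<omega> < c} \<le> c"
proof (rule field_le_epsilon)
  fix d :: real assume "0 < d"
  \<comment> \<open>Two approximation errors and the width of the ramp share the allowance \<open>d\<close>.\<close>
  define e where "e = d / 3"
  have e: "0 < e" using \<open>0 < d\<close> by (simp add: e_def)
  interpret prob_space M by fact
  define U where "U = restrict_space lborel {0..1::real}"
  interpret U: prob_space U
    by standard (simp add: U_def emeasure_restrict_space)
  have [measurable]: "(\<lambda>x. x) \<in> borel_measurable U"
    unfolding U_def by (intro measurable_restrict_space1) simp
  have mU: "{x\<in>space U. x \<le> c + e} \<in> sets U" by measurable
  have [simp]: "space U = {0..1}" by (simp add: U_def)
  define g where "g x = max 0 (min 1 ((c + e - x) / e))" for x :: real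
  have cont: "continuous_on A g" for A unfolding g_def by (intro continuous_intros) (use e in auto)
  have [measurable]: "g \<in> borel_measurable borel" by (intro borel_measurable_continuous_onI cont)
  obtain p where "real_polynomial_function p" and p: "\<And>x. x \<in> {0..1} \<Longrightarrow> \<bar>g x - p x\<bar> < e"
    using Stone_Weierstrass_real_polynomial_function[OF compact_Icc cont e] by metis
  then obtain a n where pa: "p = (\<lambda>x. \<Sum>i\<le>n. a i * x ^ i)"
    using real_polynomial_function_iff_sum by metis
  have [measurable]: "p \<in> borel_measurable borel" unfolding pa by measurable
  have pow: "integrable M (\<lambda>\<omega>. V \<omega> ^ i)" for i
    by (intro integrable_const_bound[of _ 1]) (use V01 in \<open>auto simp: power_le_one\<close>)
  have powU: "integrable U (\<lambda>x. x ^ i)" for i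
    by (intro U.integrable_const_bound[of _ 1] AE_I2) (auto simp: power_le_one)
  have momU: "(\<integral>x. x ^ i \<partial>U) = 1 / (real i + 1)" for i
    unfolding U_def using integral_power[of 0 1 i]
    by (subst integral_restrict_space) (auto simp: ac_simps)
  have gb: "0 \<le> g x" "g x \<le> 1" for x unfolding g_def by auto
  have "prob {\<omega> \<in> space M. V \<omega> < c} = (\<integral>\<omega>. indicator {\<omega> \<in> space M. V \<omega> < c} \<omega> \<partial>M)" by simp
  also have "\<dots> \<le> (\<integral>\<omega>. p (V \<omega>) + e \<partial>M)"
  proof (rule integral_mono)
    show "integrable M (\<lambda>\<omega>. p (V \<omega>) + e)" unfolding pa using pow by auto
    show "integrable M (indicator {\<omega> \<in> space M. V \<omega> < c} :: _ \<Rightarrow> real)"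
      by (intro integrable_real_indicator) (auto simp: less_top[symmetric])
    show "indicator {\<omega> \<in> space M. V \<omega> < c} \<omega> \<le> p (V \<omega>) + e" for \<omega>
      using p[of "V \<omega>"] V01[of \<omega>] gb(1)[of "V \<omega>"] e
      by (auto simp: indicator_def g_def field_simps abs_less_iff split: if_splits)
  qed
  also have "\<dots> = (\<Sum>i\<le>n. a i / (real i + 1)) + e"
    using pow mom by (subst Bochner_Integration.integral_add) (auto simp: pa prob_space)
  also have "\<dots> = (\<integral>x. p x \<partial>U) + e"
    using powU momU by (simp add: pa)
  also have "(\<integral>x. p x \<partial>U) \<le> (\<integral>x. indicator {x\<in>space U. x \<le> c + e} x + e \<partial>U)"
  proof (rule integral_mono)
    show "integrable U p" unfolding pa using powU by auto
    show "integrable U (\<lambda>x. indicator {x \<in> space U. x \<le> c + e} x + e)"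
      using mU by (intro Bochner_Integration.integrable_add integrable_real_indicator) (auto simp: less_top[symmetric])
    fix x assume "x \<in> space U"
    then show "p x \<le> indicator {x \<in> space U. x \<le> c + e} x + e"
      using p[of x] gb(2)[of x] e
      by (auto simp: indicator_def g_def field_simps abs_less_iff max_def min_def split: if_splits)
  qed
  also have "\<dots> = measure U {x\<in>space U. x \<le> c + e} + e"
    using mU by (subst Bochner_Integration.integral_add) (auto simp: U.prob_space less_top[symmetric] simp del: \<open>space U = {0..1}\<close>)
  also have "measure U {x\<in>space U. x \<le> c + e} \<le> measure lborel {0..c + e}"
  proof -
    have "{x\<in>space U. x \<le> c + e} = {0..min 1 (c + e)}" by auto
    then have "measure U {x\<in>space U. x \<le> c + e} = measure lborel {0..min 1 (c + e)}"
      unfolding U_def by (simp add: measure_restrict_space)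
    also have "\<dots> \<le> measure lborel {0..c + e}" using c e by simp
    finally show ?thesis .
  qed
  also have "\<dots> = c + e" using c e by simp
  finally show "prob {\<omega> \<in> space M. V \<omega> < c} \<le> c + d" by (simp add: e_def)
qed

text \<open>
  Here \<open>S\<close> is a parameter of the characteristic function, and \<open>S \<le> E \<bar>W\<bar>\<^sup>2\<close> is the relation to the
  second moment that the bound requires. It comes out of the Laplace transform:
  \<open>1 - l E \<bar>W\<bar>\<^sup>2 \<le> 1 / (1 + l S)\<close>, to first order as \<open>l\<close> decreases to \<open>0\<close>. This avoids computing
  \<open>E \<bar>W\<bar>\<^sup>2\<close> from the covariance function.
\<close>
lemma circular_gaussian_tail:
  fixes W :: "'a \<Rightarrow> complex"
  assumes "prob_space M" and W[measurable]: "W \<in> borel_measurable M"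
    and char: "\<And>z. (\<integral>\<omega>. iexp (Re (z * W \<omega>)) \<partial>M) = of_real (exp (- ((cmod z)\<^sup>2 * S / 4)))"
    and S: "0 \<le> S" and r: "0 \<le> r"
    and E: "0 < (\<integral>\<omega>. (cmod (W \<omega>))\<^sup>2 \<partial>M)"
  shows "measure M {\<omega> \<in> space M. r < cmod (W \<omega>)} \<le> exp (- (r\<^sup>2 / (\<integral>\<omega>. (cmod (W \<omega>))\<^sup>2 \<partial>M)))"
proof -
  interpret prob_space M by fact
  note lap = circular_gaussian_laplace[OF assms(1-4)]
  define E where "E = (\<integral>\<omega>. (cmod (W \<omega>))\<^sup>2 \<partial>M)"
  \<comment> \<open>The integral of a non-integrable function is \<open>0\<close> by convention, so positivity gives integrability.\<close>
  have int: "integrable M (\<lambda>\<omega>. (cmod (W \<omega>))\<^sup>2)"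
    using E not_integrable_integral_eq by fastforce
  have inte: "integrable M (\<lambda>\<omega>. exp (- l * (cmod (W \<omega>))\<^sup>2))" if "0 \<le> l" for l
    by (intro integrable_const_bound[of _ 1]) (use that in auto)
  have SE: "S \<le> E"
  proof -
    have *: "S / (1 + l * S) \<le> E" if l: "0 < l" for l
    proof -
      have "(\<integral>\<omega>. 1 - l * (cmod (W \<omega>))\<^sup>2 \<partial>M) \<le> (\<integral>\<omega>. exp (- l * (cmod (W \<omega>))\<^sup>2) \<partial>M)"
        using exp_ge_add_one_self[of "- l * (cmod (W \<omega>))\<^sup>2" for \<omega>] int inte[of l] l
        by (intro integral_mono) (auto simp: algebra_simps)
      then have "1 - l * E \<le> 1 / (1 + l * S)"
        using lap[of l] l int by (simp add: E_def prob_space)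
      moreover have "1 - 1 / (1 + l * S) = l * (S / (1 + l * S))"
        using l S by (simp add: field_simps add_nonneg_eq_0_iff)
      ultimately have "l * (S / (1 + l * S)) \<le> l * E" by linarith
      then show ?thesis using l by (simp only: mult_le_cancel_left_pos)
    qed
    have "((\<lambda>l. S / (1 + l * S)) \<longlongrightarrow> S / (1 + 0 * S)) (at_right 0)"
      by (intro tendsto_intros) auto
    then show ?thesis
      using * by (intro tendsto_upperbound[of _ S "at_right 0"])
        (auto simp: eventually_at_right_less eventually_at_filter)
  qed
  \<comment> \<open>For \<open>S = 0\<close> the Laplace transform is constantly \<open>1\<close>, so \<open>W\<close> vanishes almost surely.\<close>
  have "S \<noteq> 0"
  proof
    assume "S = 0"
    then have "(\<integral>\<omega>. 1 - exp (- 1 * (cmod (W \<omega>))\<^sup>2) \<partial>M) = 0"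
      using lap[of 1] inte[of 1] by (simp add: prob_space)
    then have "AE \<omega> in M. 1 - exp (- 1 * (cmod (W \<omega>))\<^sup>2) = 0"
      using inte[of 1] by (subst (asm) integral_nonneg_eq_0_iff_AE) auto
    then have "AE \<omega> in M. (cmod (W \<omega>))\<^sup>2 = 0" by simp
    then have "E = 0" unfolding E_def by (simp add: integral_eq_zero_AE)
    then show False using E by (simp add: E_def)
  qed
  then have S': "0 < S" using S by simp
  \<comment> \<open>The \<open>n\<close>-th power of \<open>V\<close> is the Laplace kernel at \<open>l = n / S\<close>, where the transform equals \<open>1 / (n + 1)\<close>.\<close>
  define V where "V \<omega> = exp (- (1 / S) * (cmod (W \<omega>))\<^sup>2)" for \<omega>
  have "(\<integral>\<omega>. V \<omega> ^ n \<partial>M) = 1 / (real n + 1)" for n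
    using lap[of "real n / S"] S' by (simp add: V_def field_simps flip: exp_of_nat_mult)
  then have "prob {\<omega> \<in> space M. V \<omega> < exp (- (r\<^sup>2 / S))} \<le> exp (- (r\<^sup>2 / S))"
    using S' by (intro prob_less_le_if_uniform_moments[OF assms(1)]) (auto simp: V_def)
  also have "{\<omega> \<in> space M. V \<omega> < exp (- (r\<^sup>2 / S))} = {\<omega> \<in> space M. r < cmod (W \<omega>)}"
    using S' r by (auto simp: V_def divide_less_cancel dest: power_less_imp_less_base intro!: power_strict_mono)
  also have "exp (- (r\<^sup>2 / S)) \<le> exp (- (r\<^sup>2 / E))"
    using S' SE by (auto intro!: divide_left_mono)
  finally show ?thesis unfolding E_def .
qed

section \<open>Gaussian variables and auxiliary measure theory\<close>

lemma gaussian_rv_moments: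
  assumes "prob_space M" and X: "gaussian_rv M X"
  shows "integrable M (\<lambda>\<omega>. (X \<omega>)\<^sup>2)"
    and "(\<integral>\<omega>. iexp (X \<omega>) \<partial>M) =
      iexp (\<integral>\<omega>. X \<omega> \<partial>M) * of_real (exp (- (covariance M X X / 2)))"
proof -
  interpret prob_space M by fact
  have [measurable]: "X \<in> borel_measurable M" using X by (simp add: gaussian_rv_def)
  obtain m \<sigma> where s: "\<sigma> \<ge> 0" and
    D: "distr M borel X = (if \<sigma> = 0 then return borel m else density lborel (normal_density m \<sigma>))"
    using X by (auto simp: gaussian_rv_def)
  have "integrable M (\<lambda>\<omega>. (X \<omega>)\<^sup>2) \<and> (\<integral>\<omega>. iexp (X \<omega>) \<partial>M) =
      iexp (\<integral>\<omega>. X \<omega> \<partial>M) * of_real (exp (- (covariance M X X / 2)))"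
  proof (cases "\<sigma> = 0")
    case True
    have "AE x in return borel m. x = m" by (subst AE_return) auto
    then have "AE x in distr M borel X. x = m" unfolding D using True by simp
    then have ae: "AE \<omega> in M. X \<omega> = m" by (subst (asm) AE_distr_iff) auto
    have "integrable M (\<lambda>\<omega>. (X \<omega>)\<^sup>2)"
      by (subst integrable_cong_AE[where g="\<lambda>_. m\<^sup>2"]) (use ae in auto)
    moreover have mean: "(\<integral>\<omega>. X \<omega> \<partial>M) = m"
      by (subst integral_cong_AE[where g="\<lambda>_. m"]) (use ae in \<open>auto simp: prob_space\<close>)
    moreover have "covariance M X X = 0"
      unfolding covariance_def mean
      by (subst integral_cong_AE[where g="\<lambda>_. 0"]) (use ae in auto)
    moreover have "(\<integral>\<omega>. iexp (X \<omega>) \<partial>M) = iexp m"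
      by (subst integral_cong_AE[where g="\<lambda>_. iexp m"]) (use ae in \<open>auto simp: prob_space\<close>)
    ultimately show ?thesis by simp
  next
    case False
    then have s: "0 < \<sigma>" using s by simp
    have "distr M lborel X = distr M borel X" by (intro distr_cong) auto
    then have N: "distributed M lborel X (normal_density m \<sigma>)"
      using D False by (auto simp: distributed_def)
    have i2: "integrable M (\<lambda>\<omega>. (X \<omega> - m)\<^sup>2)"
      using integrable_normal_moment[OF s, of m 2]
      by (subst (asm) distributed_integrable[OF N]) auto
    have i1: "integrable M X"
      using integrable_normal_moment_nz_1[OF s, of m]
      by (subst (asm) distributed_integrable[OF N]) auto
    have "(X \<omega>)\<^sup>2 = (X \<omega> - m)\<^sup>2 + 2 * m * X \<omega> - m\<^sup>2" for \<omega>
      by (simp add: power2_eq_square algebra_simps)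
    then have int: "integrable M (\<lambda>\<omega>. (X \<omega>)\<^sup>2)" using i1 i2 by simp
    have mean: "(\<integral>\<omega>. X \<omega> \<partial>M) = m" by (rule normal_distributed_expectation[OF s N])
    have var: "covariance M X X = \<sigma>\<^sup>2"
      using normal_distributed_variance[OF s N] by (simp add: covariance_def power2_eq_square)
    define Z where "Z \<omega> = (X \<omega> - m) / \<sigma>" for \<omega>
    have [measurable]: "Z \<in> borel_measurable M" unfolding Z_def by measurable
    have "distributed M lborel Z std_normal_density"
      unfolding Z_def using N normal_standard_normal_convert[OF s] by simp
    then have "distr M lborel Z = std_normal_distribution" by (simp add: distributed_def)
    moreover have "distr M lborel Z = distr M borel Z" by (intro distr_cong) auto
    ultimately have Z: "distr M borel Z = std_normal_distribution" by simp
    have "(\<integral>\<omega>. iexp (X \<omega>) \<partial>M) = (\<integral>\<omega>. iexp m * iexp (\<sigma> * Z \<omega>) \<partial>M)"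
      using s by (intro Bochner_Integration.integral_cong) (auto simp: Z_def field_simps simp flip: exp_add)
    also have "\<dots> = iexp m * (\<integral>\<omega>. iexp (\<sigma> * Z \<omega>) \<partial>M)" by simp
    also have "(\<integral>\<omega>. iexp (\<sigma> * Z \<omega>) \<partial>M) = char (distr M borel Z) \<sigma>"
      by (simp add: char_def integral_distr)
    finally show ?thesis
      using int by (simp add: Z char_std_normal_distribution mean var)
  qed
  then show "integrable M (\<lambda>\<omega>. (X \<omega>)\<^sup>2)"
    and "(\<integral>\<omega>. iexp (X \<omega>) \<partial>M) =
      iexp (\<integral>\<omega>. X \<omega> \<partial>M) * of_real (exp (- (covariance M X X / 2)))" by auto
qed

lemma sigma_finite_lebesgue: "sigma_finite_measure (lebesgue :: 'a::euclidean_space measure)"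
proof
  show "\<exists>A::'a set set. countable A \<and> A \<subseteq> sets lebesgue \<and> \<Union>A = space lebesgue \<and>
      (\<forall>a\<in>A. emeasure lebesgue a \<noteq> (\<infinity> :: ennreal))"
  proof (intro exI conjI ballI)
    show "\<Union>(range (\<lambda>n. cball (0::'a) (real n))) = space lebesgue"
      by (auto simp: real_arch_simple)
    show "emeasure lebesgue a \<noteq> \<infinity>" if "a \<in> range (\<lambda>n. cball (0::'a) (real n))" for a
      using that lmeasurable_cball[THEN fmeasurableD2] by (metis imageE infinity_ennreal_def)
  qed auto
qed

text \<open>
  This turns an integral of a process, sampled along a simple function of time, into a
  finite linear combination of its values; the same weights serve the real-valued process and
  the complex exponentials of the spectral representation.
\<close>
lemma integral_compose_simple_function:
  fixes g :: "real \<Rightarrow> 'b::{banach, second_countable_topology}"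
  assumes r: "simple_function M r" and k: "integrable M k" and M: "space M = UNIV"
  shows "(\<integral>\<tau>. k \<tau> *\<^sub>R g (r \<tau>) \<partial>M) =
      (\<Sum>y\<in>range r. (\<integral>\<tau>. indicator (r -` {y}) \<tau> * k \<tau> \<partial>M) *\<^sub>R g y)"
    and "integrable M (\<lambda>\<tau>. k \<tau> *\<^sub>R g (r \<tau>))"
proof -
  have fin: "finite (range r)" using simple_functionD(1)[OF r] M by simp
  have [measurable]: "r -` {y} \<in> sets M" for y using simple_functionD(2)[OF r, of "{y}"] M by simp
  have int: "integrable M (\<lambda>\<tau>. (indicator (r -` {y}) \<tau> * k \<tau>) *\<^sub>R g y)" for y
    using integrable_mult_indicator[OF _ k, of "r -` {y}"] by auto
  have eq: "k \<tau> *\<^sub>R g (r \<tau>) = (\<Sum>y\<in>range r. (indicator (r -` {y}) \<tau> * k \<tau>) *\<^sub>R g y)" for \<tau>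
  proof -
    have "(\<Sum>y\<in>range r. (indicator (r -` {y}) \<tau> * k \<tau>) *\<^sub>R g y) =
        (\<Sum>y\<in>range r. if y = r \<tau> then k \<tau> *\<^sub>R g y else 0)"
      by (intro sum.cong) (auto simp: indicator_def)
    then show ?thesis using fin by simp
  qed
  show "integrable M (\<lambda>\<tau>. k \<tau> *\<^sub>R g (r \<tau>))" unfolding eq using int by auto
  show "(\<integral>\<tau>. k \<tau> *\<^sub>R g (r \<tau>) \<partial>M) =
      (\<Sum>y\<in>range r. (\<integral>\<tau>. indicator (r -` {y}) \<tau> * k \<tau> \<partial>M) *\<^sub>R g y)"
    unfolding eq using int
      integrable_mult_indicator[OF _ k, of "r -` {y}" for y]
    by (subst Bochner_Integration.integral_sum) auto
qed

section \<open>Stationary Gaussian processes with a spectral measure\<close>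

locale stationary_gaussian = prob_space M
  for M :: "'a measure" +
  fixes \<Phi> :: "real \<Rightarrow> 'a \<Rightarrow> real" and C :: "real \<Rightarrow> real" and F :: "real measure"
  assumes meas: "measurable_process M \<Phi>"
    and gauss: "gaussian_process M \<Phi>"
    and stat: "stationary_with_covariance M \<Phi> C"
    and spec: "spectral_representation C F"
begin

definition \<mu> :: real where "\<mu> = expectation (\<Phi> 0)"

lemma mean: "expectation (\<Phi> t) = \<mu>"
  using stat unfolding stationary_with_covariance_def \<mu>_def by metis

lemma gaussian_value: "gaussian_rv M (\<Phi> t)"
  using gauss[unfolded gaussian_process_def, rule_format, of "{t}" "\<lambda>_. 1"] by simp

lemma measurable_value [measurable]: "\<Phi> t \<in> borel_measurable M"
  using gaussian_value by (simp add: gaussian_rv_def)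

lemma integrable_square: "integrable M (\<lambda>\<omega>. (\<Phi> t \<omega>)\<^sup>2)"
  by (rule gaussian_rv_moments(1)[OF prob_space_axioms gaussian_value])

lemma integrable_value: "integrable M (\<Phi> t)"
  by (rule square_integrable_imp_integrable) (auto intro: integrable_square)

lemma integrable_centred_product: "integrable M (\<lambda>\<omega>. (\<Phi> t \<omega> - \<mu>) * (\<Phi> u \<omega> - \<mu>))"
proof (rule Bochner_Integration.integrable_bound)
  have "integrable M (\<lambda>\<omega>. (\<Phi> v \<omega> - \<mu>)\<^sup>2)" for v
    using integrable_square[of v] integrable_value[of v] by (simp add: power2_diff)
  then show "integrable M (\<lambda>\<omega>. (\<Phi> t \<omega> - \<mu>)\<^sup>2 + (\<Phi> u \<omega> - \<mu>)\<^sup>2)" by simp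
  have "\<bar>x * y\<bar> \<le> x\<^sup>2 + y\<^sup>2" for x y :: real
  proof -
    have "2 * (\<bar>x\<bar> * \<bar>y\<bar>) \<le> x\<^sup>2 + y\<^sup>2" "0 \<le> \<bar>x\<bar> * \<bar>y\<bar>"
      using sum_squares_bound[of "\<bar>x\<bar>" "\<bar>y\<bar>"] by (simp_all add: mult.assoc)
    then show ?thesis unfolding abs_mult by linarith
  qed
  then show "AE \<omega> in M. norm ((\<Phi> t \<omega> - \<mu>) * (\<Phi> u \<omega> - \<mu>)) \<le> norm ((\<Phi> t \<omega> - \<mu>)\<^sup>2 + (\<Phi> u \<omega> - \<mu>)\<^sup>2)"
    by (auto simp: abs_of_nonneg)
qed measurable

lemma covariance_value: "expectation (\<lambda>\<omega>. (\<Phi> t \<omega> - \<mu>) * (\<Phi> u \<omega> - \<mu>)) = C (t - u)"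
  using stat by (simp add: stationary_with_covariance_def covariance_def mean)

lemma sets_F [measurable_cong]: "sets F = sets borel" and finite_measure_F: "finite_measure F"
  and C_eq: "complex_of_real (C t) = (\<integral>x. iexp (x * t) \<partial>F)"
  using spec by (auto simp: spectral_representation_def sets_eq_imp_space_eq intro!: finite_measureI)

text \<open>
  Continuity of \<open>C\<close> at the origin amounts to mean-square continuity of the process and rests on
  the finiteness of the spectral measure.
\<close>
lemma tendsto_C_0:
  assumes "h \<longlonglongrightarrow> 0"
  shows "(\<lambda>n. C (h n)) \<longlonglongrightarrow> C 0"
proof -
  interpret F: finite_measure F by (rule finite_measure_F)
  have "(\<lambda>n. iexp (x * h n)) \<longlonglongrightarrow> iexp (x * 0)" for x
    by (intro tendsto_intros assms)
  note lim = this
  have "(\<lambda>n. \<integral>x. iexp (x * h n) \<partial>F) \<longlonglongrightarrow> (\<integral>x. iexp (x * 0) \<partial>F)"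
    by (rule integral_dominated_convergence[where w="\<lambda>_. 1"])
      (use lim in \<open>auto simp del: of_real_mult\<close>)
  then show ?thesis by (simp only: C_eq[symmetric] tendsto_of_real_iff)
qed

lemma square_increment:
  "(\<Phi> t \<omega> - \<Phi> u \<omega>)\<^sup>2 = (\<Phi> t \<omega> - \<mu>) * (\<Phi> t \<omega> - \<mu>) + (\<Phi> u \<omega> - \<mu>) * (\<Phi> u \<omega> - \<mu>)
      - 2 * ((\<Phi> t \<omega> - \<mu>) * (\<Phi> u \<omega> - \<mu>))"
  by (simp add: power2_eq_square algebra_simps)

lemma expectation_abs_increment:
  "expectation (\<lambda>\<omega>. \<bar>\<Phi> t \<omega> - \<Phi> u \<omega>\<bar>) \<le> sqrt (2 * (C 0 - C (t - u)))"
proof -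
  let ?D = "\<lambda>\<omega>. \<bar>\<Phi> t \<omega> - \<Phi> u \<omega>\<bar>"
  have int: "integrable M (\<lambda>\<omega>. (\<Phi> t \<omega> - \<Phi> u \<omega>)\<^sup>2)"
    unfolding square_increment by (simp add: integrable_centred_product)
  have second: "expectation (\<lambda>\<omega>. (\<Phi> t \<omega> - \<Phi> u \<omega>)\<^sup>2) = 2 * (C 0 - C (t - u))"
    unfolding square_increment by (simp add: integrable_centred_product covariance_value)
  have "variance ?D = expectation (\<lambda>\<omega>. (?D \<omega>)\<^sup>2) - (expectation ?D)\<^sup>2"
    using integrable_value int by (intro variance_eq) simp_all
  moreover have "0 \<le> variance ?D" by (rule variance_positive)
  ultimately have "(expectation ?D)\<^sup>2 \<le> 2 * (C 0 - C (t - u))"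
    using second by simp
  then show ?thesis by (rule real_le_rsqrt)
qed

lemma expectation_abs_bounded: "\<exists>K. \<forall>t. expectation (\<lambda>\<omega>. \<bar>\<Phi> t \<omega>\<bar>) \<le> K"
proof (intro exI allI)
  fix t
  have "\<bar>x\<bar> \<le> \<bar>\<mu>\<bar> + (1 + (x - \<mu>) * (x - \<mu>))" for x
  proof -
    have "\<bar>y\<bar> \<le> 1 + y\<^sup>2" for y :: real
    proof (cases "\<bar>y\<bar> \<le> 1")
      case True
      then show ?thesis using zero_le_power2[of y] by linarith
    next
      case False
      then show ?thesis using self_le_power[of "\<bar>y\<bar>" 2] unfolding power2_abs by linarith
    qed
    from this[of "x - \<mu>"] have "\<bar>x - \<mu>\<bar> \<le> 1 + (x - \<mu>) * (x - \<mu>)"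
      by (simp only: power2_eq_square)
    then show ?thesis by linarith
  qed
  then have "expectation (\<lambda>\<omega>. \<bar>\<Phi> t \<omega>\<bar>) \<le> expectation (\<lambda>\<omega>. \<bar>\<mu>\<bar> + (1 + (\<Phi> t \<omega> - \<mu>) * (\<Phi> t \<omega> - \<mu>)))"
    using integrable_value integrable_centred_product by (intro integral_mono) auto
  also have "\<dots> = \<bar>\<mu>\<bar> + (1 + C 0)"
    using integrable_centred_product by (simp add: covariance_value prob_space)
  finally show "expectation (\<lambda>\<omega>. \<bar>\<Phi> t \<omega>\<bar>) \<le> \<bar>\<mu>\<bar> + (1 + C 0)" .
qed

text \<open>
  The variance is expressed through the spectral measure, since in this form
  it passes to the limit of infinitely many sampling points by dominated convergence.
\<close>
lemma char_linear_combination: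
  assumes I: "finite I"
  shows "expectation (\<lambda>\<omega>. iexp (\<Sum>y\<in>I. a y * \<Phi> y \<omega>)) =
    iexp (\<mu> * (\<Sum>y\<in>I. a y)) * of_real (exp (- ((\<integral>x. (cmod (\<Sum>y\<in>I. a y *\<^sub>R iexp (x * y)))\<^sup>2 \<partial>F) / 2)))"
proof -
  interpret F: finite_measure F by (rule finite_measure_F)
  let ?Z = "\<lambda>\<omega>. \<Sum>y\<in>I. a y * \<Phi> y \<omega>"
  have Z: "gaussian_rv M ?Z" by (rule gauss[unfolded gaussian_process_def, rule_format, OF I])
  have EZ: "expectation ?Z = \<mu> * (\<Sum>y\<in>I. a y)"
  proof -
    have "expectation ?Z = (\<Sum>y\<in>I. a y * \<mu>)" using integrable_value by (simp add: mean)
    also have "\<dots> = \<mu> * (\<Sum>y\<in>I. a y)" unfolding mult.commute[of \<mu>] by (rule sum_distrib_right[symmetric])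
    finally show ?thesis .
  qed
  have "(?Z \<omega> - \<mu> * (\<Sum>y\<in>I. a y)) * (?Z \<omega> - \<mu> * (\<Sum>y\<in>I. a y)) =
      (\<Sum>y\<in>I. \<Sum>u\<in>I. a y * a u * ((\<Phi> y \<omega> - \<mu>) * (\<Phi> u \<omega> - \<mu>)))" for \<omega>
  proof -
    have "?Z \<omega> - \<mu> * (\<Sum>y\<in>I. a y) = (\<Sum>y\<in>I. a y * (\<Phi> y \<omega> - \<mu>))"
      by (simp only: sum_distrib_left right_diff_distrib sum_subtractf mult.commute[of \<mu>])
    then show ?thesis by (simp add: sum_product mult_ac)
  qed
  then have var: "covariance M ?Z ?Z = (\<Sum>y\<in>I. \<Sum>u\<in>I. a y * a u * C (y - u))"
    using integrable_centred_product by (simp add: covariance_def EZ covariance_value)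
  have int: "integrable F (\<lambda>x. iexp (x * h))" for h
    by (rule F.integrable_const_bound[of _ 1]) (auto simp del: of_real_mult)
  have "complex_of_real ((cmod (\<Sum>y\<in>I. a y *\<^sub>R iexp (x * y)))\<^sup>2) =
      (\<Sum>y\<in>I. \<Sum>u\<in>I. (a y * a u) *\<^sub>R iexp (x * (y - u)))" for x
  proof -
    have "iexp (x * y) * cnj (iexp (x * u)) = iexp (x * (y - u))" for y u
      by (simp add: exp_cnj algebra_simps flip: exp_add)
    then show ?thesis
      by (simp add: complex_norm_square cnj_sum sum_product scaleR_conv_of_real mult_ac
          del: of_real_mult of_real_power)
        (intro sum.cong refl; simp add: mult_ac)
  qed
  then have "complex_of_real (\<integral>x. (cmod (\<Sum>y\<in>I. a y *\<^sub>R iexp (x * y)))\<^sup>2 \<partial>F) =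
      (\<integral>x. (\<Sum>y\<in>I. \<Sum>u\<in>I. (a y * a u) *\<^sub>R iexp (x * (y - u))) \<partial>F)"
    by (simp only: integral_complex_of_real[symmetric])
  also have "\<dots> = (\<Sum>y\<in>I. \<Sum>u\<in>I. (a y * a u) *\<^sub>R complex_of_real (C (y - u)))"
    using int by (simp add: C_eq del: of_real_mult of_real_diff)
  also have "\<dots> = complex_of_real (covariance M ?Z ?Z)"
    by (simp add: var scaleR_conv_of_real)
  finally have "(\<integral>x. (cmod (\<Sum>y\<in>I. a y *\<^sub>R iexp (x * y)))\<^sup>2 \<partial>F) = covariance M ?Z ?Z"
    by (simp only: of_real_eq_iff)
  then show ?thesis
    using gaussian_rv_moments(2)[OF prob_space_axioms Z] by (simp only: EZ)
qed

end

section \<open>Integrals of the paths of a stationary Gaussian process\<close>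

lemma norm_iexp_diff_le: "cmod (iexp a - iexp b) \<le> \<bar>a - b\<bar>"
proof -
  have "iexp a - iexp b = iexp b * (iexp (a - b) - 1)"
    by (simp add: algebra_simps flip: exp_add)
  then have "cmod (iexp a - iexp b) = cmod (iexp (a - b) - 1)"
    by (simp add: norm_mult)
  also have "\<dots> \<le> \<bar>a - b\<bar>" using iexp_approx1[of "a - b" 0] by simp
  finally show ?thesis .
qed

lemma measurable_ident_lebesgue_borel: "(\<lambda>\<tau>. \<tau>) \<in> borel_measurable (lebesgue :: real measure)"
  by (intro measurable_completion) simp

lemma measurable_iexp_lebesgue [measurable]:
  "(\<lambda>\<tau>. iexp (x * \<tau>)) \<in> borel_measurable lebesgue"
  using measurable_ident_lebesgue_borel[measurable] by measurable

context stationary_gaussian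
begin

lemma measurable_joint: "(\<lambda>(\<tau>, \<omega>). \<Phi> \<tau> \<omega>) \<in> borel_measurable (lebesgue \<Otimes>\<^sub>M M)"
  using meas by (simp add: measurable_process_def)

lemma measurable_joint_swap [measurable]: "(\<lambda>(\<omega>, \<tau>). \<Phi> \<tau> \<omega>) \<in> borel_measurable (M \<Otimes>\<^sub>M lebesgue)"
  using measurable_pair_swap[OF measurable_joint] by (simp add: case_prod_beta)

text \<open>
  The first absolute moment of \<open>\<Phi>\<close> is bounded in time, so Fubini applies to the product with an integrable
  weight. In particular almost every path is integrable against the weight, which is what gives the
  pathwise integral a meaning.
\<close>
lemma integrable_weighted_path:
  fixes k :: "real \<Rightarrow> 'b::{banach, second_countable_topology, real_normed_algebra_1}"
  assumes k: "integrable lebesgue k"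
  shows "integrable (lebesgue \<Otimes>\<^sub>M M) (\<lambda>(\<tau>, \<omega>). \<Phi> \<tau> \<omega> *\<^sub>R k \<tau>)"
proof -
  interpret L: sigma_finite_measure "lebesgue :: real measure" by (rule sigma_finite_lebesgue)
  interpret P: pair_sigma_finite "lebesgue :: real measure" M ..
  note [measurable] = measurable_joint borel_measurable_integrable[OF k]
  obtain K where K: "\<And>t. expectation (\<lambda>\<omega>. \<bar>\<Phi> t \<omega>\<bar>) \<le> K" using expectation_abs_bounded by auto
  show ?thesis
  proof (rule P.Fubini_integrable)
    show "integrable lebesgue (\<lambda>\<tau>. \<integral>\<omega>. norm (case (\<tau>, \<omega>) of (\<tau>, \<omega>) \<Rightarrow> \<Phi> \<tau> \<omega> *\<^sub>R k \<tau>) \<partial>M)"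
    proof (rule Bochner_Integration.integrable_bound)
      show "integrable lebesgue (\<lambda>\<tau>. K * norm (k \<tau>))" using k by auto
      show "AE \<tau> in lebesgue. norm (\<integral>\<omega>. norm (case (\<tau>, \<omega>) of (\<tau>, \<omega>) \<Rightarrow> \<Phi> \<tau> \<omega> *\<^sub>R k \<tau>) \<partial>M)
          \<le> norm (K * norm (k \<tau>))"
        using K by (intro AE_I2) (auto simp: abs_mult intro!: mult_right_mono intro: order_trans[OF K abs_ge_self])
    qed measurable
  qed (auto simp: case_prod_beta integrable_value)
qed

text \<open>
  Let \<open>r\<^sub>n\<close> be simple functions with \<open>r\<^sub>n(\<tau>) \<longlongrightarrow> \<tau>\<close>, and let \<open>X\<^sub>n\<close> be the integral with \<open>\<Phi>(r\<^sub>n(\<tau>))\<close> in place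
  of \<open>\<Phi>(\<tau>)\<close>. Then \<open>X\<^sub>n\<close> is a finite linear combination of values of \<open>\<Phi>\<close>, so its characteristic function
  is known, and \<open>E \<bar>X\<^sub>n - X\<bar>\<close> is at most the integral of \<open>\<bar>k(\<tau>)\<bar> E \<bar>\<Phi>(r\<^sub>n(\<tau>)) - \<Phi>(\<tau>)\<bar>\<close>, which tends to \<open>0\<close> by
  continuity of the covariance function and dominated convergence.
\<close>
lemma char_path_integral:
  assumes k: "integrable lebesgue k"
  shows "expectation (\<lambda>\<omega>. iexp (\<integral>\<tau>. k \<tau> * \<Phi> \<tau> \<omega> \<partial>lebesgue)) =
    iexp (\<mu> * (\<integral>\<tau>. k \<tau> \<partial>lebesgue)) *
    of_real (exp (- ((\<integral>x. (cmod (\<integral>\<tau>. k \<tau> *\<^sub>R iexp (x * \<tau>) \<partial>lebesgue))\<^sup>2 \<partial>F) / 2)))"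
proof -
  interpret F: finite_measure F by (rule finite_measure_F)
  interpret L: sigma_finite_measure "lebesgue :: real measure" by (rule sigma_finite_lebesgue)
  interpret P: pair_sigma_finite "lebesgue :: real measure" M ..
  note [measurable] = measurable_joint borel_measurable_integrable[OF k]
  from borel_measurable_implies_sequence_metric[OF measurable_ident_lebesgue_borel, of 0]
  obtain r :: "nat \<Rightarrow> real \<Rightarrow> real" where r: "\<And>n. simple_function lebesgue (r n)"
    and r_lim: "\<And>\<tau>. (\<lambda>n. r n \<tau>) \<longlonglongrightarrow> \<tau>" by auto
  have r_fin: "finite (range (r n))" for n using simple_functionD(1)[OF r] by simp
  have r_L [measurable]: "r n \<in> lebesgue \<rightarrow>\<^sub>M lebesgue" for n
    by (rule measurable_compose[OF measurable_simple_function[OF r]]) simp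
  have [measurable]: "r n \<in> borel_measurable lebesgue" for n
    by (rule borel_measurable_simple_function[OF r])
  have joint_r [measurable]: "(\<lambda>p. \<Phi> (r n (fst p)) (snd p)) \<in> borel_measurable (lebesgue \<Otimes>\<^sub>M M)" for n
  proof -
    have "(\<lambda>p. (r n (fst p), snd p)) \<in> lebesgue \<Otimes>\<^sub>M M \<rightarrow>\<^sub>M lebesgue \<Otimes>\<^sub>M M" by measurable
    from measurable_compose[OF this measurable_joint] show ?thesis by simp
  qed
  have joint' [measurable]: "(\<lambda>p. \<Phi> (fst p) (snd p)) \<in> borel_measurable (lebesgue \<Otimes>\<^sub>M M)"
    using measurable_joint by (simp add: case_prod_beta)

  define c where "c n y = (\<integral>\<tau>. indicator (r n -` {y}) \<tau> * k \<tau> \<partial>lebesgue)" for n y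
  note simple = integral_compose_simple_function[OF r k, folded c_def]
  define X where "X \<omega> = (\<integral>\<tau>. k \<tau> * \<Phi> \<tau> \<omega> \<partial>lebesgue)" for \<omega>
  define Xn where "Xn n \<omega> = (\<integral>\<tau>. k \<tau> * \<Phi> (r n \<tau>) \<omega> \<partial>lebesgue)" for n \<omega>
  define kh where "kh x = (\<integral>\<tau>. k \<tau> *\<^sub>R iexp (x * \<tau>) \<partial>lebesgue)" for x
  define khn where "khn n x = (\<integral>\<tau>. k \<tau> *\<^sub>R iexp (x * r n \<tau>) \<partial>lebesgue)" for n x
  have Xn_sum: "Xn n \<omega> = (\<Sum>y\<in>range (r n). c n y * \<Phi> y \<omega>)" for n \<omega>
    using simple(1)[where g="\<lambda>y. \<Phi> y \<omega>"] by (simp add: Xn_def)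
  have khn_sum: "khn n x = (\<Sum>y\<in>range (r n). c n y *\<^sub>R iexp (x * y))" for n x
    using simple(1)[where g="\<lambda>y. iexp (x * y)"] by (simp add: khn_def)
  have k_sum: "(\<integral>\<tau>. k \<tau> \<partial>lebesgue) = (\<Sum>y\<in>range (r n). c n y)" for n
    using simple(1)[where g="\<lambda>y. 1::real"] by simp
  have char_n: "expectation (\<lambda>\<omega>. iexp (Xn n \<omega>)) = iexp (\<mu> * (\<integral>\<tau>. k \<tau> \<partial>lebesgue)) *
      of_real (exp (- ((\<integral>x. (cmod (khn n x))\<^sup>2 \<partial>F) / 2)))" for n
    unfolding Xn_sum khn_sum k_sum[of n] by (rule char_linear_combination[OF r_fin])

  have kh_meas: "kh \<in> borel_measurable F" "khn n \<in> borel_measurable F" for n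
  proof -
    note [measurable] = measurable_ident_lebesgue_borel
    have [measurable]: "(\<lambda>(x, \<tau>). k \<tau> *\<^sub>R iexp (x * \<tau>)) \<in> borel_measurable (F \<Otimes>\<^sub>M lebesgue)"
      "(\<lambda>(x, \<tau>). k \<tau> *\<^sub>R iexp (x * r n \<tau>)) \<in> borel_measurable (F \<Otimes>\<^sub>M lebesgue)"
      by measurable
    show "kh \<in> borel_measurable F" "khn n \<in> borel_measurable F"
      unfolding kh_def khn_def by measurable
  qed
  note [measurable] = kh_meas

  have kh_lim: "(\<lambda>n. khn n x) \<longlonglongrightarrow> kh x" for x
    unfolding kh_def khn_def
  proof (rule integral_dominated_convergence[where w="\<lambda>\<tau>. \<bar>k \<tau>\<bar>"])
    have "(\<lambda>n. k \<tau> *\<^sub>R iexp (x * r n \<tau>)) \<longlonglongrightarrow> k \<tau> *\<^sub>R iexp (x * \<tau>)" for \<tau>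
      by (intro tendsto_intros r_lim)
    then show "AE \<tau> in lebesgue. (\<lambda>n. k \<tau> *\<^sub>R iexp (x * r n \<tau>)) \<longlonglongrightarrow> k \<tau> *\<^sub>R iexp (x * \<tau>)" by simp
  qed (use k in \<open>auto simp del: of_real_mult\<close>)
  have khn_bound: "cmod (khn n x) \<le> (\<integral>\<tau>. \<bar>k \<tau>\<bar> \<partial>lebesgue)" for n x
    unfolding khn_def by (rule order_trans[OF integral_norm_bound]) (simp del: of_real_mult)
  have "(\<lambda>n. \<integral>x. (cmod (khn n x))\<^sup>2 \<partial>F) \<longlonglongrightarrow> (\<integral>x. (cmod (kh x))\<^sup>2 \<partial>F)"
  proof (rule integral_dominated_convergence[where w="\<lambda>_. (\<integral>\<tau>. \<bar>k \<tau>\<bar> \<partial>lebesgue)\<^sup>2"])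
    show "AE x in F. (\<lambda>n. (cmod (khn n x))\<^sup>2) \<longlonglongrightarrow> (cmod (kh x))\<^sup>2"
      by (intro AE_I2 tendsto_intros kh_lim)
    show "AE x in F. norm ((cmod (khn n x))\<^sup>2) \<le> (\<integral>\<tau>. \<bar>k \<tau>\<bar> \<partial>lebesgue)\<^sup>2" for n
      using power_mono[OF khn_bound, of n _ 2] by simp
  qed auto
  then have rhs: "(\<lambda>n. expectation (\<lambda>\<omega>. iexp (Xn n \<omega>))) \<longlonglongrightarrow> iexp (\<mu> * (\<integral>\<tau>. k \<tau> \<partial>lebesgue)) *
      of_real (exp (- ((\<integral>x. (cmod (kh x))\<^sup>2 \<partial>F) / 2)))"
    unfolding char_n by (intro tendsto_intros) simp_all

  \<comment> \<open>The error of the \<open>n\<close>-th approximation, as a function \<open>D n\<close> on the product space whose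
    mean over outcomes at a fixed time is \<open>d n\<close>.\<close>
  obtain K where K: "\<And>t. expectation (\<lambda>\<omega>. \<bar>\<Phi> t \<omega>\<bar>) \<le> K" using expectation_abs_bounded by auto
  define D where "D n = (\<lambda>(\<tau>, \<omega>). k \<tau> * (\<Phi> (r n \<tau>) \<omega> - \<Phi> \<tau> \<omega>))" for n
  have D_meas [measurable]: "D n \<in> borel_measurable (lebesgue \<Otimes>\<^sub>M M)" for n
    unfolding D_def case_prod_beta by measurable
  define d where "d n \<tau> = expectation (\<lambda>\<omega>. \<bar>D n (\<tau>, \<omega>)\<bar>)" for n \<tau>
  have d_eq: "d n \<tau> = \<bar>k \<tau>\<bar> * expectation (\<lambda>\<omega>. \<bar>\<Phi> (r n \<tau>) \<omega> - \<Phi> \<tau> \<omega>\<bar>)" for n \<tau>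
    by (simp add: d_def D_def abs_mult)
  have d_meas [measurable]: "d n \<in> borel_measurable lebesgue" for n
    unfolding d_def by measurable
  have d_bound: "\<bar>d n \<tau>\<bar> \<le> \<bar>k \<tau>\<bar> * (2 * K)" for n \<tau>
  proof -
    have "expectation (\<lambda>\<omega>. \<bar>\<Phi> (r n \<tau>) \<omega> - \<Phi> \<tau> \<omega>\<bar>) \<le> expectation (\<lambda>\<omega>. \<bar>\<Phi> (r n \<tau>) \<omega>\<bar> + \<bar>\<Phi> \<tau> \<omega>\<bar>)"
      using integrable_value by (intro integral_mono) auto
    also have "\<dots> \<le> 2 * K"
      using K[of "r n \<tau>"] K[of \<tau>] integrable_value by simp
    finally show ?thesis by (simp add: d_eq abs_mult mult_left_mono)
  qed
  have d_lim: "(\<lambda>n. d n \<tau>) \<longlonglongrightarrow> 0" for \<tau>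
  proof -
    have "(\<lambda>n. r n \<tau> - \<tau>) \<longlonglongrightarrow> \<tau> - \<tau>" by (intro tendsto_intros r_lim)
    then have "(\<lambda>n. C (r n \<tau> - \<tau>)) \<longlonglongrightarrow> C 0" by (intro tendsto_C_0) simp
    then have "(\<lambda>n. \<bar>k \<tau>\<bar> * sqrt (2 * (C 0 - C (r n \<tau> - \<tau>)))) \<longlonglongrightarrow> \<bar>k \<tau>\<bar> * sqrt (2 * (C 0 - C 0))"
      by (intro tendsto_intros)
    then have lim: "(\<lambda>n. \<bar>k \<tau>\<bar> * sqrt (2 * (C 0 - C (r n \<tau> - \<tau>)))) \<longlonglongrightarrow> 0" by simp
    have "d n \<tau> \<le> \<bar>k \<tau>\<bar> * sqrt (2 * (C 0 - C (r n \<tau> - \<tau>)))" for n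
      unfolding d_eq by (intro mult_left_mono expectation_abs_increment) simp
    then show ?thesis
      by (intro tendsto_sandwich[OF _ _ tendsto_const lim] always_eventually) (auto simp: d_eq)
  qed
  have d_int: "integrable lebesgue (d n)" for n
    by (rule Bochner_Integration.integrable_bound[of _ "\<lambda>\<tau>. \<bar>k \<tau>\<bar> * (2 * K)"])
      (use k d_bound in \<open>auto intro: order_trans[OF d_bound abs_ge_self]\<close>)
  have d_int_lim: "(\<lambda>n. \<integral>\<tau>. d n \<tau> \<partial>lebesgue) \<longlonglongrightarrow> integral\<^sup>L lebesgue (\<lambda>\<tau>::real. 0)"
    by (rule integral_dominated_convergence[where w="\<lambda>\<tau>. \<bar>k \<tau>\<bar> * (2 * K)"])
      (use k d_bound d_lim in auto)
  have D_int: "integrable (lebesgue \<Otimes>\<^sub>M M) (D n)" for n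
  proof (rule P.Fubini_integrable)
    show "integrable lebesgue (\<lambda>\<tau>. expectation (\<lambda>\<omega>. norm (D n (\<tau>, \<omega>))))"
      using d_int[of n] by (simp add: d_def[abs_def])
    show "AE \<tau> in lebesgue. integrable M (\<lambda>\<omega>. D n (\<tau>, \<omega>))"
      using integrable_value by (simp add: D_def)
  qed measurable
  have X_meas [measurable]: "X \<in> borel_measurable M"
    unfolding X_def by measurable
  have Xn_meas [measurable]: "Xn n \<in> borel_measurable M" for n
    unfolding Xn_sum[abs_def] by measurable
  have path: "AE \<omega> in M. integrable lebesgue (\<lambda>\<tau>. k \<tau> * \<Phi> \<tau> \<omega>)"
    using P.AE_integrable_snd[of "\<lambda>\<tau> \<omega>. k \<tau> * \<Phi> \<tau> \<omega>"] integrable_weighted_path[OF k]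
    by (simp add: mult.commute)
  have diff: "expectation (\<lambda>\<omega>. \<bar>Xn n \<omega> - X \<omega>\<bar>) \<le> (\<integral>\<tau>. d n \<tau> \<partial>lebesgue)"
    "integrable M (\<lambda>\<omega>. Xn n \<omega> - X \<omega>)" for n
  proof -
    have iD: "integrable (lebesgue \<Otimes>\<^sub>M M) (case_prod (\<lambda>\<tau> \<omega>. D n (\<tau>, \<omega>)))"
      using D_int by simp
    have iaD: "integrable (lebesgue \<Otimes>\<^sub>M M) (case_prod (\<lambda>\<tau> \<omega>. \<bar>D n (\<tau>, \<omega>)\<bar>))"
      using integrable_abs[OF D_int[of n]] unfolding case_prod_beta prod.collapse .
    have eq: "AE \<omega> in M. Xn n \<omega> - X \<omega> = (\<integral>\<tau>. D n (\<tau>, \<omega>) \<partial>lebesgue)"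
      using path
    proof eventually_elim
      case (elim \<omega>)
      then show ?case
        using simple(2)[where g="\<lambda>y. \<Phi> y \<omega>"] by (simp add: Xn_def X_def D_def right_diff_distrib)
    qed
    have "integrable M (\<lambda>\<omega>. \<integral>\<tau>. D n (\<tau>, \<omega>) \<partial>lebesgue)" by (rule P.integrable_snd[OF iD])
    then show int: "integrable M (\<lambda>\<omega>. Xn n \<omega> - X \<omega>)"
      by (subst integrable_cong_AE[OF _ _ eq]) auto
    have "expectation (\<lambda>\<omega>. \<bar>Xn n \<omega> - X \<omega>\<bar>) \<le> expectation (\<lambda>\<omega>. \<integral>\<tau>. \<bar>D n (\<tau>, \<omega>)\<bar> \<partial>lebesgue)"
    proof (rule integral_mono_AE)
      show "AE \<omega> in M. \<bar>Xn n \<omega> - X \<omega>\<bar> \<le> (\<integral>\<tau>. \<bar>D n (\<tau>, \<omega>)\<bar> \<partial>lebesgue)"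
        using eq by eventually_elim (simp add: integral_abs_bound)
      show "integrable M (\<lambda>\<omega>. \<integral>\<tau>. \<bar>D n (\<tau>, \<omega>)\<bar> \<partial>lebesgue)" by (rule P.integrable_snd[OF iaD])
    qed (use int in auto)
    also have "\<dots> = (\<integral>\<tau>. d n \<tau> \<partial>lebesgue)"
      unfolding d_def by (rule P.Fubini_integral[OF iaD])
    finally show "expectation (\<lambda>\<omega>. \<bar>Xn n \<omega> - X \<omega>\<bar>) \<le> (\<integral>\<tau>. d n \<tau> \<partial>lebesgue)" .
  qed
  have int_iexp: "integrable M (\<lambda>\<omega>. iexp (Z \<omega>))" if [measurable]: "Z \<in> borel_measurable M" for Z
    by (rule integrable_const_bound[of _ 1]) auto
  have "(\<lambda>n. expectation (\<lambda>\<omega>. iexp (Xn n \<omega>)) - expectation (\<lambda>\<omega>. iexp (X \<omega>))) \<longlonglongrightarrow> 0"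
  proof (rule tendsto_0_le[OF d_int_lim[simplified], of _ 1], intro always_eventually allI)
    fix n
    have "cmod (expectation (\<lambda>\<omega>. iexp (Xn n \<omega>)) - expectation (\<lambda>\<omega>. iexp (X \<omega>))) =
        cmod (expectation (\<lambda>\<omega>. iexp (Xn n \<omega>) - iexp (X \<omega>)))"
      by (simp add: int_iexp)
    also have "\<dots> \<le> expectation (\<lambda>\<omega>. cmod (iexp (Xn n \<omega>) - iexp (X \<omega>)))" by (rule integral_norm_bound)
    also have "\<dots> \<le> expectation (\<lambda>\<omega>. \<bar>Xn n \<omega> - X \<omega>\<bar>)"
      using diff(2) int_iexp by (intro integral_mono) (auto intro: norm_iexp_diff_le)
    finally show "cmod (expectation (\<lambda>\<omega>. iexp (Xn n \<omega>)) - expectation (\<lambda>\<omega>. iexp (X \<omega>)))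
        \<le> norm (\<integral>\<tau>. d n \<tau> \<partial>lebesgue) * 1"
      using diff(1)[of n] by simp
  qed
  then have "(\<lambda>n. expectation (\<lambda>\<omega>. iexp (Xn n \<omega>))) \<longlonglongrightarrow> expectation (\<lambda>\<omega>. iexp (X \<omega>))"
    by (simp add: LIM_zero_iff)
  from LIMSEQ_unique[OF this rhs] show ?thesis unfolding X_def kh_def .
qed

text \<open>
  The real part of \<open>z W\<close> is the path integral with real weight \<open>k = Re (z \<kappa>)\<close>, whose Fourier transform
  at \<open>x\<close> is \<open>(z h(x) + cnj (z h(-x))) / 2\<close> with \<open>h\<close> that of \<open>\<kappa>\<close>. Since \<open>h\<close> vanishes on the nonpositive axis, at most one of the two
  summands is nonzero; the squared modulus has no cross term and depends on \<open>z\<close> only through its modulus.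
  Vanishing at \<open>x = 0\<close> removes the mean of the process. The normalisation by \<open>4\<close> makes \<open>S\<close>
  the second absolute moment of \<open>W\<close>.
\<close>
lemma circular_of_analytic_kernel:
  fixes \<kappa> :: "real \<Rightarrow> complex"
  assumes \<kappa>: "integrable lebesgue \<kappa>"
    and analytic: "\<And>x. x \<le> 0 \<Longrightarrow> (\<integral>\<tau>. iexp (x * \<tau>) * \<kappa> \<tau> \<partial>lebesgue) = 0"
  obtains S where "0 \<le> S"
    "\<And>z. expectation (\<lambda>\<omega>. iexp (Re (z * (\<integral>\<tau>. of_real (\<Phi> \<tau> \<omega>) * \<kappa> \<tau> \<partial>lebesgue)))) =
      of_real (exp (- ((cmod z)\<^sup>2 * S / 4)))"
proof
  interpret L: sigma_finite_measure "lebesgue :: real measure" by (rule sigma_finite_lebesgue)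
  interpret P: pair_sigma_finite "lebesgue :: real measure" M ..
  note [measurable] = measurable_joint borel_measurable_integrable[OF \<kappa>]
  define h where "h x = (\<integral>\<tau>. iexp (x * \<tau>) * \<kappa> \<tau> \<partial>lebesgue)" for x
  let ?S = "(\<integral>x. (cmod (h x))\<^sup>2 + (cmod (h (- x)))\<^sup>2 \<partial>F) / 2"
  show "0 \<le> ?S" by simp
  fix z
  define k where "k \<tau> = Re (z * \<kappa> \<tau>)" for \<tau>
  have int_h: "integrable lebesgue (\<lambda>\<tau>. iexp (x * \<tau>) * \<kappa> \<tau>)" for x
    by (rule Bochner_Integration.integrable_bound[OF \<kappa>]) (auto simp: norm_mult simp del: of_real_mult)
  have k: "integrable lebesgue k" unfolding k_def using \<kappa> by auto
  have kh: "(\<integral>\<tau>. k \<tau> *\<^sub>R iexp (x * \<tau>) \<partial>lebesgue) = (z * h x + cnj (z * h (- x))) / 2" for x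
  proof -
    have "k \<tau> *\<^sub>R iexp (x * \<tau>) = (z * (iexp (x * \<tau>) * \<kappa> \<tau>) + cnj z * cnj (iexp (- x * \<tau>) * \<kappa> \<tau>)) / 2" for \<tau>
    proof -
      have "complex_of_real (k \<tau>) = (z * \<kappa> \<tau> + cnj (z * \<kappa> \<tau>)) / 2"
        unfolding k_def complex_add_cnj by simp
      moreover have "cnj (iexp (- x * \<tau>)) = iexp (x * \<tau>)" by (simp add: exp_cnj)
      ultimately show ?thesis
        by (simp add: scaleR_conv_of_real algebra_simps add_divide_distrib)
    qed
    then have "(\<integral>\<tau>. k \<tau> *\<^sub>R iexp (x * \<tau>) \<partial>lebesgue) =
        (z * h x + cnj z * (\<integral>\<tau>. cnj (iexp (- x * \<tau>) * \<kappa> \<tau>) \<partial>lebesgue)) / 2"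
      using int_h unfolding h_def
      by (simp only: integral_divide_zero integral_mult_right_zero integrable_cnj integrable_mult_right
          Bochner_Integration.integral_add)
    then show ?thesis by (simp only: Bochner_Integration.integral_cnj h_def complex_cnj_mult[of z])
  qed
  have k0: "(\<integral>\<tau>. k \<tau> \<partial>lebesgue) = 0"
  proof -
    have "(\<integral>\<tau>. \<kappa> \<tau> \<partial>lebesgue) = 0" using analytic[of 0] by simp
    then show ?thesis unfolding k_def using \<kappa> by simp
  qed
  have modulus: "(cmod ((z * h x + cnj (z * h (- x))) / 2))\<^sup>2 =
      (cmod z)\<^sup>2 / 4 * ((cmod (h x))\<^sup>2 + (cmod (h (- x)))\<^sup>2)" for x
  proof (cases "x \<le> 0")
    case True
    then have "h x = 0" unfolding h_def by (rule analytic)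
    then show ?thesis by (simp add: norm_divide norm_mult power_mult_distrib power_divide)
  next
    case False
    then have "h (- x) = 0" unfolding h_def by (intro analytic) simp
    then show ?thesis by (simp add: norm_divide norm_mult power_mult_distrib power_divide)
  qed
  have "expectation (\<lambda>\<omega>. iexp (\<integral>\<tau>. k \<tau> * \<Phi> \<tau> \<omega> \<partial>lebesgue)) =
      of_real (exp (- ((cmod z)\<^sup>2 * ?S / 4)))"
    unfolding char_path_integral[OF k] kh modulus by (simp add: k0)
  moreover have "AE \<omega> in M. integrable lebesgue (\<lambda>\<tau>. of_real (\<Phi> \<tau> \<omega>) * \<kappa> \<tau>)"
    using P.AE_integrable_snd[OF integrable_weighted_path[OF \<kappa>]] by (simp add: scaleR_conv_of_real)
  then have "AE \<omega> in M. Re (z * (\<integral>\<tau>. of_real (\<Phi> \<tau> \<omega>) * \<kappa> \<tau> \<partial>lebesgue)) = (\<integral>\<tau>. k \<tau> * \<Phi> \<tau> \<omega> \<partial>lebesgue)"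
  proof eventually_elim
    case (elim \<omega>)
    have "(\<integral>\<tau>. k \<tau> * \<Phi> \<tau> \<omega> \<partial>lebesgue) = (\<integral>\<tau>. Re (z * (of_real (\<Phi> \<tau> \<omega>) * \<kappa> \<tau>)) \<partial>lebesgue)"
      by (intro Bochner_Integration.integral_cong) (auto simp: k_def algebra_simps)
    also have "\<dots> = Re (z * (\<integral>\<tau>. of_real (\<Phi> \<tau> \<omega>) * \<kappa> \<tau> \<partial>lebesgue))"
      using elim by (subst integral_Re) (auto simp del: Re_complex_of_real)
    finally show ?case ..
  qed
  note re_eq = this
  have "expectation (\<lambda>\<omega>. iexp (Re (z * (\<integral>\<tau>. of_real (\<Phi> \<tau> \<omega>) * \<kappa> \<tau> \<partial>lebesgue)))) =
      expectation (\<lambda>\<omega>. iexp (\<integral>\<tau>. k \<tau> * \<Phi> \<tau> \<omega> \<partial>lebesgue))"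
  proof (rule integral_cong_AE)
    show "AE \<omega> in M. iexp (Re (z * (\<integral>\<tau>. of_real (\<Phi> \<tau> \<omega>) * \<kappa> \<tau> \<partial>lebesgue))) =
        iexp (\<integral>\<tau>. k \<tau> * \<Phi> \<tau> \<omega> \<partial>lebesgue)"
      using re_eq by eventually_elim (simp only:)
    have [measurable]: "k \<in> borel_measurable lebesgue" using k by simp
    show "(\<lambda>\<omega>. iexp (\<integral>\<tau>. k \<tau> * \<Phi> \<tau> \<omega> \<partial>lebesgue)) \<in> borel_measurable M" by measurable
  qed measurable
  ultimately show "expectation (\<lambda>\<omega>. iexp (Re (z * (\<integral>\<tau>. of_real (\<Phi> \<tau> \<omega>) * \<kappa> \<tau> \<partial>lebesgue)))) =
      of_real (exp (- ((cmod z)\<^sup>2 * ?S / 4)))" by simp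
qed

end

section \<open>The wavelet transform of signal and noise\<close>

definition wavelet_kernel :: "(real \<Rightarrow> complex) \<Rightarrow> real \<Rightarrow> real \<Rightarrow> real \<Rightarrow> complex" where
  "wavelet_kernel \<psi> t s \<tau> = of_real (1 / sqrt s) * cnj (\<psi> ((\<tau> - t) / s))"

lemma awt_eq_integral_kernel:
  "awt \<psi> g t s = (\<integral>\<tau>. of_real (g \<tau>) * wavelet_kernel \<psi> t s \<tau> \<partial>lebesgue)"
  by (simp add: awt_def wavelet_kernel_def mult.assoc)

lemma integrable_wavelet_kernel:
  assumes \<psi>: "integrable lebesgue \<psi>" and s: "0 < s"
  shows "integrable lebesgue (wavelet_kernel \<psi> t s)"
proof -
  have "integrable lebesgue (\<lambda>\<tau>. \<psi> (- t / s + (1 / s) * \<tau>))"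
    using \<psi> s by (subst lebesgue_integrable_real_affine_iff) auto
  also have "(\<lambda>\<tau>. \<psi> (- t / s + (1 / s) * \<tau>)) = (\<lambda>\<tau>. \<psi> ((\<tau> - t) / s))"
    by (simp add: diff_divide_distrib)
  finally show ?thesis unfolding wavelet_kernel_def by (intro integrable_mult_right integrable_cnj)
qed

lemma fourier_wavelet_kernel:
  assumes s: "0 < s"
  shows "(\<integral>\<tau>. iexp (x * \<tau>) * wavelet_kernel \<psi> t s \<tau> \<partial>lebesgue) =
    of_real (sqrt s) * iexp (x * t) * cnj (fourier \<psi> (s * x))"
proof -
  have "(\<integral>\<tau>. iexp (x * \<tau>) * wavelet_kernel \<psi> t s \<tau> \<partial>lebesgue) =
      \<bar>s\<bar> *\<^sub>R (\<integral>u. iexp (x * (t + s * u)) * wavelet_kernel \<psi> t s (t + s * u) \<partial>lebesgue)"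
    using s by (intro lebesgue_integral_real_affine) simp
  also have "(\<lambda>u. iexp (x * (t + s * u)) * wavelet_kernel \<psi> t s (t + s * u)) =
      (\<lambda>u. (iexp (x * t) * of_real (1 / sqrt s)) * cnj (exp (- (\<i> * of_real (u * (s * x)))) * \<psi> u))"
    using s by (intro ext) (simp add: wavelet_kernel_def exp_cnj ring_distribs exp_add mult_ac)
  also have "(\<integral>u. (iexp (x * t) * of_real (1 / sqrt s)) * cnj (exp (- (\<i> * of_real (u * (s * x)))) * \<psi> u) \<partial>lebesgue) =
      (iexp (x * t) * of_real (1 / sqrt s)) * cnj (fourier \<psi> (s * x))"
    by (simp only: integral_mult_right_zero Bochner_Integration.integral_cnj fourier_def)
  also have "\<bar>s\<bar> *\<^sub>R ((iexp (x * t) * of_real (1 / sqrt s)) * cnj (fourier \<psi> (s * x))) =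
      of_real (s / sqrt s) * iexp (x * t) * cnj (fourier \<psi> (s * x))"
    using s by (simp add: scaleR_conv_of_real)
  also have "s / sqrt s = sqrt s" using s by (simp add: real_div_sqrt)
  finally show ?thesis .
qed

lemma (in stationary_gaussian) wavelet_noise_tail:
  assumes \<psi>: "integrable lebesgue \<psi>" "\<And>w. w \<le> 0 \<Longrightarrow> fourier \<psi> w = 0"
    and s: "0 < s" and r: "0 \<le> r"
    and E: "0 < expectation (\<lambda>\<omega>. (cmod (awt \<psi> (\<lambda>\<tau>. \<Phi> \<tau> \<omega>) t s))\<^sup>2)"
  shows "{\<omega> \<in> space M. r < cmod (awt \<psi> (\<lambda>\<tau>. \<Phi> \<tau> \<omega>) t s)} \<in> events"
    and "prob {\<omega> \<in> space M. r < cmod (awt \<psi> (\<lambda>\<tau>. \<Phi> \<tau> \<omega>) t s)}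
      \<le> exp (- (r\<^sup>2 / expectation (\<lambda>\<omega>. (cmod (awt \<psi> (\<lambda>\<tau>. \<Phi> \<tau> \<omega>) t s))\<^sup>2)))"
proof -
  interpret L: sigma_finite_measure "lebesgue :: real measure" by (rule sigma_finite_lebesgue)
  note \<kappa> = integrable_wavelet_kernel[OF \<psi>(1) s, of t]
  note [measurable] = measurable_joint borel_measurable_integrable[OF \<kappa>]
  have W: "(\<lambda>\<omega>. awt \<psi> (\<lambda>\<tau>. \<Phi> \<tau> \<omega>) t s) \<in> borel_measurable M"
    unfolding awt_eq_integral_kernel by measurable
  then show "{\<omega> \<in> space M. r < cmod (awt \<psi> (\<lambda>\<tau>. \<Phi> \<tau> \<omega>) t s)} \<in> events" by measurable
  have "(\<integral>\<tau>. iexp (x * \<tau>) * wavelet_kernel \<psi> t s \<tau> \<partial>lebesgue) = 0" if "x \<le> 0" for x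
    using \<psi>(2)[of "s * x"] s that
    by (simp only: fourier_wavelet_kernel) (simp add: mult_nonneg_nonpos)
  then obtain S where "0 \<le> S"
    "\<And>z. expectation (\<lambda>\<omega>. iexp (Re (z * awt \<psi> (\<lambda>\<tau>. \<Phi> \<tau> \<omega>) t s))) =
      of_real (exp (- ((cmod z)\<^sup>2 * S / 4)))"
    unfolding awt_eq_integral_kernel using circular_of_analytic_kernel[OF \<kappa>] by blast
  then show "prob {\<omega> \<in> space M. r < cmod (awt \<psi> (\<lambda>\<tau>. \<Phi> \<tau> \<omega>) t s)}
      \<le> exp (- (r\<^sup>2 / expectation (\<lambda>\<omega>. (cmod (awt \<psi> (\<lambda>\<tau>. \<Phi> \<tau> \<omega>) t s))\<^sup>2)))"
    using circular_gaussian_tail[OF prob_space_axioms W _ _ r E] by blast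
qed

text \<open>
  Additivity holds only for almost every outcome: on the remaining paths the noise may fail to be integrable
  against the kernel, and its transform is then \<open>0\<close> by convention.
\<close>
lemma (in stationary_gaussian) AE_awt_add_noise:
  assumes \<psi>: "integrable lebesgue \<psi>" and s: "0 < s"
    and f: "f \<in> borel_measurable lebesgue" "bounded (range f)"
  shows "AE \<omega> in M. awt \<psi> (\<lambda>\<tau>. f \<tau> + \<Phi> \<tau> \<omega>) t s = awt \<psi> f t s + awt \<psi> (\<lambda>\<tau>. \<Phi> \<tau> \<omega>) t s"
proof -
  interpret L: sigma_finite_measure "lebesgue :: real measure" by (rule sigma_finite_lebesgue)
  interpret P: pair_sigma_finite "lebesgue :: real measure" M ..
  note \<kappa> = integrable_wavelet_kernel[OF \<psi> s, of t]
  note [measurable] = borel_measurable_integrable[OF \<kappa>] f(1)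
  obtain B where B: "\<And>x. \<bar>f x\<bar> \<le> B" using f(2) by (auto simp: bounded_iff)
  have fk: "integrable lebesgue (\<lambda>\<tau>. of_real (f \<tau>) * wavelet_kernel \<psi> t s \<tau>)"
  proof (rule Bochner_Integration.integrable_bound)
    show "integrable lebesgue (\<lambda>\<tau>. B * norm (wavelet_kernel \<psi> t s \<tau>))" using \<kappa> by auto
    show "AE \<tau> in lebesgue. norm (of_real (f \<tau>) * wavelet_kernel \<psi> t s \<tau>) \<le> norm (B * norm (wavelet_kernel \<psi> t s \<tau>))"
      using order_trans[OF B abs_ge_self] by (intro AE_I2) (auto simp: norm_mult abs_mult intro!: mult_right_mono)
  qed measurable
  have "AE \<omega> in M. integrable lebesgue (\<lambda>\<tau>. of_real (\<Phi> \<tau> \<omega>) * wavelet_kernel \<psi> t s \<tau>)"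
    using P.AE_integrable_snd[OF integrable_weighted_path[OF \<kappa>]] by (simp add: scaleR_conv_of_real)
  then show ?thesis
    by eventually_elim (use fk in \<open>simp add: awt_eq_integral_kernel distrib_right\<close>)
qed

text \<open>
  If neither noise term exceeds the fraction \<open>\<epsilon>\<close> of its signal, then \<open>\<bar>a + x\<bar> \<ge> (1 - \<epsilon>) \<bar>a\<bar>\<close> and
  \<open>(1 - \<delta>) \<bar>b + y\<bar> \<le> (1 + \<epsilon>) (1 - \<delta>) \<bar>b\<bar>\<close>, and the right-hand sides agree by the choice of \<open>\<epsilon>\<close>: both are the
  harmonic mean of \<open>\<bar>a\<bar>\<close> and \<open>(1 - \<delta>) \<bar>b\<bar>\<close>.
\<close>
lemma ridge_misplaced_imp_noise_large:
  fixes a b x y :: complex and \<delta> \<epsilon> :: real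
  assumes ab: "cmod b < cmod a" and \<delta>: "0 \<le> \<delta>" "\<delta> < 1"
    and \<epsilon>: "\<epsilon> = (cmod a - (1 - \<delta>) * cmod b) / (cmod a + (1 - \<delta>) * cmod b)"
    and less: "cmod (a + x) < (1 - \<delta>) * cmod (b + y)"
  shows "\<epsilon> * cmod a < cmod x \<or> \<epsilon> * cmod b < cmod y"
proof (rule ccontr)
  assume "\<not> ?thesis"
  then have x: "cmod x \<le> \<epsilon> * cmod a" and y: "cmod y \<le> \<epsilon> * cmod b" by auto
  define B where "B = (1 - \<delta>) * cmod b"
  have "0 \<le> B" using \<delta> by (simp add: B_def)
  then have pos: "0 < cmod a + B" using ab norm_ge_zero[of b] by linarith
  have "\<epsilon> * (cmod a + B) = cmod a - B" using pos by (simp add: \<epsilon> B_def)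
  then have midpoint: "(1 - \<epsilon>) * cmod a = (1 + \<epsilon>) * B" by (simp add: algebra_simps)
  have "(1 - \<delta>) * cmod (b + y) \<le> (1 - \<delta>) * (cmod b + \<epsilon> * cmod b)"
    using \<delta> y norm_triangle_ineq[of b y] by (intro mult_left_mono) auto
  also have "\<dots> = (1 + \<epsilon>) * B" by (simp add: B_def algebra_simps)
  also have "\<dots> = cmod a - \<epsilon> * cmod a" using midpoint by (simp add: algebra_simps)
  also have "\<dots> \<le> cmod (a + x)" using x norm_diff_ineq[of a x] by linarith
  finally show False using less by simp
qed

theorem proposition3:
  fixes M :: "'a measure"
    and \<psi> :: "real \<Rightarrow> complex"
    and f :: "real \<Rightarrow> real"
    and \<Phi> Y :: "real \<Rightarrow> 'a \<Rightarrow> real"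
    and C :: "real \<Rightarrow> real"
    and F :: "real measure"
    and Wf :: "real \<Rightarrow> real \<Rightarrow> complex"
    and W\<Phi> WY :: "real \<Rightarrow> real \<Rightarrow> 'a \<Rightarrow> complex"
    and q :: "real \<Rightarrow> real \<Rightarrow> real"
    and t s sf \<delta> \<epsilon> :: real
  assumes "prob_space M"
    and "analytic_mother_wavelet \<psi>"
    and "f \<in> borel_measurable lebesgue" and "bounded (range f)"
    and "measurable_process M \<Phi>"
    and "gaussian_process M \<Phi>"
    and "stationary_with_covariance M \<Phi> C"
    and "spectral_representation C F"
    and Y: "Y = (\<lambda>\<tau> \<omega>. f \<tau> + \<Phi> \<tau> \<omega>)"
    and Wf: "Wf = awt \<psi> f"
    and W\<Phi>: "W\<Phi> = (\<lambda>t' s' \<omega>. awt \<psi> (\<lambda>\<tau>. \<Phi> \<tau> \<omega>) t' s')"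
    and WY: "WY = (\<lambda>t' s' \<omega>. awt \<psi> (\<lambda>\<tau>. Y \<tau> \<omega>) t' s')"
    and "\<exists>!s'. is_arg_max (\<lambda>u. cmod (Wf t u)) (\<lambda>u. u > 0) s'"
    and sf: "sf = arg_max (\<lambda>u. cmod (Wf t u)) (\<lambda>u. u > 0)"
    and "s > 0" and "s \<noteq> sf"
    and "0 \<le> \<delta>" and "\<delta> < 1"
    and "(LINT \<omega>|M. (cmod (W\<Phi> t s \<omega>))\<^sup>2) > 0"
    and "(LINT \<omega>|M. (cmod (W\<Phi> t sf \<omega>))\<^sup>2) > 0"
    and q: "\<And>s'. s' \<in> {s, sf} \<Longrightarrow>
          q t s' = (cmod (Wf t s'))\<^sup>2 / (LINT \<omega>|M. (cmod (W\<Phi> t s' \<omega>))\<^sup>2)"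
    and \<epsilon>: "\<epsilon> = (cmod (Wf t sf) - (1 - \<delta>) * cmod (Wf t s)) /
                  (cmod (Wf t sf) + (1 - \<delta>) * cmod (Wf t s))"
  shows "measure M {\<omega> \<in> space M. cmod (WY t sf \<omega>) < (1 - \<delta>) * cmod (WY t s \<omega>)}
      \<le> exp (- (\<epsilon>\<^sup>2 / 16) * q t sf) + exp (- (\<epsilon> / 2) * q t sf)
        + exp (- (\<epsilon>\<^sup>2 / 16) * q t s) + exp (- (\<epsilon> / 2) * q t s)"
proof -
  interpret stationary_gaussian M \<Phi> C F
    using assms by (intro stationary_gaussian.intro stationary_gaussian_axioms.intro) auto
  have \<psi>: "integrable lebesgue \<psi>" "\<And>w. w \<le> 0 \<Longrightarrow> fourier \<psi> w = 0"
    using \<open>analytic_mother_wavelet \<psi>\<close> by (auto simp: analytic_mother_wavelet_def)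
  let ?max = "is_arg_max (\<lambda>u. cmod (Wf t u)) (\<lambda>u. u > 0)"
  have max: "?max sf"
    unfolding sf arg_max_def using \<open>\<exists>!s'. ?max s'\<close> by (metis someI_ex)
  then have sf0: "0 < sf" by (simp add: is_arg_max_def)
  \<comment> \<open>The maximiser is unique, so every other scale has a strictly smaller transform.\<close>
  have less: "cmod (Wf t s) < cmod (Wf t sf)"
  proof (rule ccontr)
    assume "\<not> cmod (Wf t s) < cmod (Wf t sf)"
    then have "?max s" using max \<open>0 < s\<close> by (fastforce simp: is_arg_max_linorder)
    then show False using max \<open>\<exists>!s'. ?max s'\<close> \<open>s \<noteq> sf\<close> by blast
  qed
  have "(1 - \<delta>) * cmod (Wf t s) \<le> 1 * cmod (Wf t s)"
    using \<open>0 \<le> \<delta>\<close> by (intro mult_right_mono) auto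
  then have \<epsilon>0: "0 \<le> \<epsilon>" using less \<open>\<delta> < 1\<close> unfolding \<epsilon> by (intro divide_nonneg_nonneg add_nonneg_nonneg) auto
  define N where "N s' = {\<omega> \<in> space M. \<epsilon> * cmod (Wf t s') < cmod (W\<Phi> t s' \<omega>)}" for s'
  have N: "N s' \<in> events" "prob (N s') \<le> exp (- (\<epsilon>\<^sup>2 / 16) * q t s')" if s': "s' \<in> {s, sf}" for s'
  proof -
    let ?E = "expectation (\<lambda>\<omega>. (cmod (W\<Phi> t s' \<omega>))\<^sup>2)"
    have "0 < s'" and E: "0 < ?E" using s' assms(15,19,20) sf0 by auto
    note tail = wavelet_noise_tail[OF \<psi> this(1) _ this(2)[unfolded W\<Phi>], of "\<epsilon> * cmod (Wf t s')"]
    show "N s' \<in> events" unfolding N_def W\<Phi> using \<epsilon>0 by (intro tail mult_nonneg_nonneg norm_ge_zero)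
    have "prob (N s') \<le> exp (- ((\<epsilon> * cmod (Wf t s'))\<^sup>2 / ?E))"
      unfolding N_def W\<Phi> using \<epsilon>0 by (intro tail mult_nonneg_nonneg norm_ge_zero)
    also have "(\<epsilon> * cmod (Wf t s'))\<^sup>2 / ?E = \<epsilon>\<^sup>2 * q t s'"
      by (simp add: q[OF s'] power_mult_distrib)
    also have "exp (- (\<epsilon>\<^sup>2 * q t s')) \<le> exp (- (\<epsilon>\<^sup>2 / 16) * q t s')"
    proof -
      have "0 \<le> \<epsilon>\<^sup>2 * q t s'" using E by (simp add: q[OF s'])
      then have "(\<epsilon>\<^sup>2 / 16) * q t s' \<le> \<epsilon>\<^sup>2 * q t s'" unfolding times_divide_eq_left by linarith
      then show ?thesis by simp
    qed
    finally show "prob (N s') \<le> exp (- (\<epsilon>\<^sup>2 / 16) * q t s')" .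
  qed
  have "AE \<omega> in M. WY t s' \<omega> = Wf t s' + W\<Phi> t s' \<omega>" if "0 < s'" for s'
    unfolding WY Wf W\<Phi> Y by (rule AE_awt_add_noise[OF \<psi>(1) that assms(3,4)])
  from this[OF sf0] this[OF \<open>0 < s\<close>]
  have "AE \<omega> in M. cmod (WY t sf \<omega>) < (1 - \<delta>) * cmod (WY t s \<omega>) \<longrightarrow>
      \<epsilon> * cmod (Wf t sf) < cmod (W\<Phi> t sf \<omega>) \<or> \<epsilon> * cmod (Wf t s) < cmod (W\<Phi> t s \<omega>)"
    by eventually_elim
      (use ridge_misplaced_imp_noise_large[OF less \<open>0 \<le> \<delta>\<close> \<open>\<delta> < 1\<close> \<epsilon>] in auto)
  then have "AE \<omega> in M. \<omega> \<in> {\<omega> \<in> space M. cmod (WY t sf \<omega>) < (1 - \<delta>) * cmod (WY t s \<omega>)} \<longrightarrow>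
      \<omega> \<in> N sf \<union> N s"
    by eventually_elim (auto simp: N_def)
  then have "measure M {\<omega> \<in> space M. cmod (WY t sf \<omega>) < (1 - \<delta>) * cmod (WY t s \<omega>)} \<le> prob (N sf \<union> N s)"
    using N(1) by (intro finite_measure_mono_AE) auto
  also have "\<dots> \<le> prob (N sf) + prob (N s)" using N(1) by (intro measure_Un_le) auto
  also have "\<dots> \<le> exp (- (\<epsilon>\<^sup>2 / 16) * q t sf) + exp (- (\<epsilon>\<^sup>2 / 16) * q t s)"
    using N(2) by (intro add_mono) auto
  finally show ?thesis using exp_ge_zero[of "- (\<epsilon> / 2) * q t sf"] exp_ge_zero[of "- (\<epsilon> / 2) * q t s"] by linarith
qed

end
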